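(* Let $X\subset\mathbb{R}^n$ be a compact robust heteroclinic network comprised of equilibria $\xi_j$ and a finite number of one-dimensional connections. Suppose that there exists an equilibrium $\xi_j\in X$ such that $\dim W^u(\xi_j)\ge 2$. Then $X$ is not asymptotically stable.
   Context: Let $\dot x=f(x)$ be a smooth vector field on $\mathbb{R}^n$, equivariant under a compact Lie group $\Gamma$ ($f(\gamma x)=\gamma f(x)$), with flow $\Phi_t$. For an equilibrium $\xi$, $W^u(\xi)$ and $W^s(\xi)$ are its unstable and stable manifolds. A heteroclinic cycle consists of equilibria $\xi_1,\dots,\xi_m$ and trajectories (connections) $\kappa_{j,j+1}=[\xi_j\to\xi_{j+1}]\subset W^u(\xi_j)\cap W^s(\xi_{j+1})\neq\varnothing$, $j=1,\dots,m$, where $\xi_{m+1}=\gamma\xi_1$ for some $\gamma\in\Gamma$. Equilibria (and connections) in the same $\Gamma$-orbit are identified. A heteroclinic network is a connected set that is the union of two or more heteroclinic cycles. A cycle or network is robust when each connection lies in a fixed-point space $\mathrm{Fix}(\Sigma)=\{x:\sigma x=x\ \forall\sigma\in\Sigma\}$ of a subgroup $\Sigma\subset\Gamma$, and within this space the connection goes from a saddle to a sink. For a compact invariant set $X$ and $\delta>0$, the $\delta$-basin of attraction is $\mathcal{B}_\delta(X)=\{x\in\mathbb{R}^n: d(\Phi_t(x),X)<\delta \text{ for all } t>0 \text{ and } \lim_{t\to+\infty}d(\Phi_t(x),X)=0\}$, and $N_\varepsilon(X)$ is the $\varepsilon$-neighbourhood of $X$. $X$ is asymptotically stable if for any $\delta>0$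 there is $\varepsilon>0$ with $N_\varepsilon(X)\subset\mathcal{B}_\delta(X)$. *)

theory Defs
  imports "HOL-Analysis.Analysis"
begin

section \<open>Smooth maps and submanifolds of Euclidean space\<close>

text \<open>The set \<open>S\<close> is meant to be open, so that \<open>at x\<close> is the right filter.\<close>

primrec Ck_on :: "nat \<Rightarrow> 'a::euclidean_space set \<Rightarrow> ('a \<Rightarrow> 'b::real_normed_vector) \<Rightarrow> bool"
where
  "Ck_on 0 S f \<longleftrightarrow> continuous_on S f"
| "Ck_on (Suc k) S f \<longleftrightarrow>
     (\<forall>x\<in>S. f differentiable (at x)) \<and>
     (\<forall>v. Ck_on k S (\<lambda>x. frechet_derivative f (at x) v))"

definition smooth_on :: "'a::euclidean_space set \<Rightarrow> ('a \<Rightarrow> 'b::real_normed_vector) \<Rightarrow> bool"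
  where "smooth_on S f \<longleftrightarrow> (\<forall>k. Ck_on k S f)"

text \<open>Submanifolds of dimension \<open>k\<close> carrying the subspace topology, described by slice charts:
  a local diffeomorphism of the ambient space straightens \<open>S\<close> to a \<open>k\<close>-dimensional
  linear subspace.\<close>

definition embedded_submanifold :: "nat \<Rightarrow> 'a::euclidean_space set \<Rightarrow> bool"
  where "embedded_submanifold k S \<longleftrightarrow>
    (\<forall>p\<in>S. \<exists>U V (\<psi> :: 'a \<Rightarrow> 'a) (\<psi>' :: 'a \<Rightarrow> 'a) (L :: 'a set).
        open U \<and> p \<in> U \<and> open V \<and>
        smooth_on U \<psi> \<and> smooth_on V \<psi>' \<and> homeomorphism U V \<psi> \<psi>' \<and>
        subspace L \<and> dim L = k \<and> \<psi> ` (S \<inter> U) = L \<inter> V)"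

text \<open>Injectively immersed submanifolds, as unstable manifolds generally are: the manifold
  topology \<open>T\<close> may be finer than the subspace topology, but locally (with respect to \<open>T\<close>) the
  inclusion is an embedding. Hausdorffness of \<open>T\<close> follows; second countability is what
  makes \<open>k\<close> unique for nonempty \<open>S\<close>.\<close>

definition immersed_submanifold :: "nat \<Rightarrow> 'a::euclidean_space set \<Rightarrow> bool"
  where "immersed_submanifold k S \<longleftrightarrow>
    (\<exists>T. topspace T = S \<and> second_countable T \<and>
       (\<forall>p\<in>S. \<exists>N. openin T N \<and> p \<in> N \<and> subtopology T N = top_of_set N \<and>
                  embedded_submanifold k N))"

section \<open>The flow of a vector field\<close>

text \<open>Completeness of the vector field is not assumed: \<open>flow f t x\<close> is meaningful for
  \<open>t \<in> flow_times f x\<close>, the maximal existence interval of the solution starting at \<open>x\<close>.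
  The solution is unique when \<open>f\<close> is smooth.\<close>

definition flow_to ::
    "('a::euclidean_space \<Rightarrow> 'a) \<Rightarrow> real \<Rightarrow> 'a \<Rightarrow> 'a \<Rightarrow> bool"
  where "flow_to f t x y \<longleftrightarrow>
    (\<exists>\<phi>. \<phi> 0 = x \<and> \<phi> t = y \<and>
       (\<forall>s\<in>closed_segment 0 t.
          (\<phi> has_vector_derivative f (\<phi> s)) (at s within closed_segment 0 t)))"

definition flow_times :: "('a::euclidean_space \<Rightarrow> 'a) \<Rightarrow> 'a \<Rightarrow> real set"
  where "flow_times f x = {t. \<exists>y. flow_to f t x y}"

definition flow :: "('a::euclidean_space \<Rightarrow> 'a) \<Rightarrow> real \<Rightarrow> 'a \<Rightarrow> 'a"
  where "flow f t x = (THE y. flow_to f t x y)"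

definition trajectory :: "('a::euclidean_space \<Rightarrow> 'a) \<Rightarrow> 'a \<Rightarrow> 'a set"
  where "trajectory f x = (\<lambda>t. flow f t x) ` flow_times f x"

definition unstable_manifold :: "('a::euclidean_space \<Rightarrow> 'a) \<Rightarrow> 'a \<Rightarrow> 'a set"
  where "unstable_manifold f \<xi> =
    {x. {..0} \<subseteq> flow_times f x \<and> ((\<lambda>t. flow f t x) \<longlongrightarrow> \<xi>) at_bot}"

definition stable_manifold :: "('a::euclidean_space \<Rightarrow> 'a) \<Rightarrow> 'a \<Rightarrow> 'a set"
  where "stable_manifold f \<xi> =
    {x. {0..} \<subseteq> flow_times f x \<and> ((\<lambda>t. flow f t x) \<longlongrightarrow> \<xi>) at_top}"

definition basin :: "('a::euclidean_space \<Rightarrow> 'a) \<Rightarrow> real \<Rightarrow> 'a set \<Rightarrow> 'a set"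
  where "basin f \<delta> X =
    {x. {0..} \<subseteq> flow_times f x \<and>
        (\<forall>t>0. infdist (flow f t x) X < \<delta>) \<and>
        ((\<lambda>t. infdist (flow f t x) X) \<longlongrightarrow> 0) at_top}"

definition nbhd :: "real \<Rightarrow> 'a::metric_space set \<Rightarrow> 'a set"
  where "nbhd \<epsilon> X = {x. infdist x X < \<epsilon>}"

definition asymptotically_stable :: "('a::euclidean_space \<Rightarrow> 'a) \<Rightarrow> 'a set \<Rightarrow> bool"
  where "asymptotically_stable f X \<longleftrightarrow> (\<forall>\<delta>>0. \<exists>\<epsilon>>0. nbhd \<epsilon> X \<subseteq> basin f \<delta> X)"

section \<open>Symmetry\<close>

text \<open>A compact Lie group acting linearly on \<open>real^'n\<close> enters only through its image in the
  general linear group. These images are exactly the compact groups of invertible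
  matrices, every such group being a Lie group.\<close>

definition matrix_group :: "(real^'n^'n) set \<Rightarrow> bool"
  where "matrix_group G \<longleftrightarrow>
    mat 1 \<in> G \<and> (\<forall>A\<in>G. \<forall>B\<in>G. A ** B \<in> G) \<and>
    (\<forall>A\<in>G. invertible A \<and> matrix_inv A \<in> G)"

definition equivariant :: "(real^'n^'n) set \<Rightarrow> (real^'n \<Rightarrow> real^'n) \<Rightarrow> bool"
  where "equivariant G f \<longleftrightarrow> (\<forall>\<gamma>\<in>G. \<forall>x. f (\<gamma> *v x) = \<gamma> *v f x)"

definition Fix :: "(real^'n^'n) set \<Rightarrow> (real^'n) set"
  where "Fix \<Sigma> = {x. \<forall>\<sigma>\<in>\<Sigma>. \<sigma> *v x = x}"

definition group_orbit :: "(real^'n^'n) set \<Rightarrow> (real^'n) set \<Rightarrow> (real^'n) set"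
  where "group_orbit G S = (\<Union>\<gamma>\<in>G. (\<lambda>x. \<gamma> *v x) ` S)"

section \<open>Saddles and sinks within an invariant subspace\<close>

text \<open>Complex eigenvalues of the restriction of the real operator \<open>A\<close> to an invariant subspace
  \<open>L\<close>: separating real and imaginary parts in \<open>A (u + \<i> v) = \<mu> (u + \<i> v)\<close>.\<close>

definition eigenvalue_on :: "('a::real_vector \<Rightarrow> 'a) \<Rightarrow> 'a set \<Rightarrow> complex \<Rightarrow> bool"
  where "eigenvalue_on A L \<mu> \<longleftrightarrow>
    (\<exists>u\<in>L. \<exists>v\<in>L. (u \<noteq> 0 \<or> v \<noteq> 0) \<and>
       A u = Re \<mu> *\<^sub>R u - Im \<mu> *\<^sub>R v \<and>
       A v = Im \<mu> *\<^sub>R u + Re \<mu> *\<^sub>R v)"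

definition saddle_in :: "('a::euclidean_space \<Rightarrow> 'a) \<Rightarrow> 'a set \<Rightarrow> 'a \<Rightarrow> bool"
  where "saddle_in f L \<xi> \<longleftrightarrow> \<xi> \<in> L \<and> f \<xi> = 0 \<and>
    (\<exists>\<mu>. eigenvalue_on (frechet_derivative f (at \<xi>)) L \<mu> \<and> Re \<mu> > 0) \<and>
    (\<exists>\<mu>. eigenvalue_on (frechet_derivative f (at \<xi>)) L \<mu> \<and> Re \<mu> < 0)"

definition sink_in :: "('a::euclidean_space \<Rightarrow> 'a) \<Rightarrow> 'a set \<Rightarrow> 'a \<Rightarrow> bool"
  where "sink_in f L \<xi> \<longleftrightarrow> \<xi> \<in> L \<and> f \<xi> = 0 \<and>
    (\<forall>\<mu>. eigenvalue_on (frechet_derivative f (at \<xi>)) L \<mu> \<longrightarrow> Re \<mu> < 0)"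

section \<open>Heteroclinic cycles and networks\<close>

definition is_connection ::
    "('a::euclidean_space \<Rightarrow> 'a) \<Rightarrow> 'a \<Rightarrow> 'a \<Rightarrow> 'a set \<Rightarrow> bool"
  where "is_connection f p q K \<longleftrightarrow>
    (\<exists>x \<in> unstable_manifold f p \<inter> stable_manifold f q. f x \<noteq> 0 \<and> K = trajectory f x)"

text \<open>The data \<open>m\<close>, \<open>\<xi>\<^sub>1, \<dots>, \<xi>\<^sub>m, \<xi>\<^sub>m\<^sub>+\<^sub>1\<close> and \<open>\<kappa>\<^sub>1\<^sub>,\<^sub>2, \<dots>, \<kappa>\<^sub>m\<^sub>,\<^sub>m\<^sub>+\<^sub>1\<close> of a cycle; \<open>conn c j\<close> is
  \<open>\<kappa>\<^sub>j\<^sub>,\<^sub>j\<^sub>+\<^sub>1\<close>. Values at other indices are irrelevant.\<close>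

record 'a cycle_data =
  len :: nat
  node :: "nat \<Rightarrow> 'a"
  conn :: "nat \<Rightarrow> 'a set"

definition heteroclinic_cycle ::
    "(real^'n \<Rightarrow> real^'n) \<Rightarrow> (real^'n^'n) set \<Rightarrow> (real^'n) cycle_data \<Rightarrow> bool"
  where "heteroclinic_cycle f G c \<longleftrightarrow>
    len c \<ge> 1 \<and>
    (\<forall>j\<in>{1..len c}. f (node c j) = 0 \<and>
        is_connection f (node c j) (node c (j + 1)) (conn c j)) \<and>
    (\<exists>\<gamma>\<in>G. node c (len c + 1) = \<gamma> *v node c 1)"

definition cycle_equilibria :: "'a cycle_data \<Rightarrow> 'a set"
  where "cycle_equilibria c = node c ` {1..len c}"

definition cycle_connections :: "'a cycle_data \<Rightarrow> 'a set set"
  where "cycle_connections c = conn c ` {1..len c}"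

definition cycle_set :: "'a cycle_data \<Rightarrow> 'a set"
  where "cycle_set c = cycle_equilibria c \<union> \<Union> (cycle_connections c)"

text \<open>\<open>C\<close> is the family of cycles making up \<open>X\<close>. Since equilibria and connections in the same
  group orbit are identified, \<open>two or more\<close> cycles are two cycles that remain different
  after passing to group orbits. A network given as a union of group orbits of cycles
  is covered: a translate of a cycle by an element of \<open>G\<close> is again a cycle and may belong
  to \<open>C\<close>.\<close>

definition heteroclinic_network ::
    "(real^'n \<Rightarrow> real^'n) \<Rightarrow> (real^'n^'n) set \<Rightarrow> (real^'n) cycle_data set \<Rightarrow> (real^'n) set \<Rightarrow> bool"
  where "heteroclinic_network f G C X \<longleftrightarrow>
    (\<forall>c\<in>C. heteroclinic_cycle f G c) \<and>
    (\<exists>c\<in>C. \<exists>c'\<in>C. group_orbit G (cycle_set c) \<noteq> group_orbit G (cycle_set c')) \<and>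
    X = (\<Union>c\<in>C. cycle_set c) \<and> connected X"

definition robust_cycle ::
    "(real^'n \<Rightarrow> real^'n) \<Rightarrow> (real^'n^'n) set \<Rightarrow> (real^'n) cycle_data \<Rightarrow> bool"
  where "robust_cycle f G c \<longleftrightarrow>
    (\<forall>j\<in>{1..len c}. \<exists>\<Sigma>. \<Sigma> \<subseteq> G \<and> matrix_group \<Sigma> \<and> conn c j \<subseteq> Fix \<Sigma> \<and>
        saddle_in f (Fix \<Sigma>) (node c j) \<and> sink_in f (Fix \<Sigma>) (node c (j + 1)))"

end

theory Submission
  imports Defs
begin

text \<open>If \<open>X\<close> is asymptotically stable, it contains the unstable manifold of each of its equilibria:
  a point of \<open>W\<^sup>u(\<xi>)\<close> off \<open>X\<close> at distance \<open>d\<close> would come from points arbitrarily close to \<open>X\<close>,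
  contradicting stability with \<open>\<delta> = d\<close>. But \<open>X\<close> is a countable union of points and \<open>C\<^sup>1\<close> arcs,
  whereas a manifold of dimension at least \<open>2\<close> projects, through a slice chart, onto a set with
  nonempty interior in the plane, and the projections of the arcs are negligible.\<close>

section \<open>Uniqueness of solutions\<close>

lemma smooth_on_differentiable:
  assumes "smooth_on S f" "x \<in> S"
  shows "f differentiable (at x)"
proof -
  have "Ck_on (Suc 0) S f" using assms(1) unfolding smooth_on_def by blast
  with assms(2) show ?thesis by simp
qed

text \<open>The partial derivatives are continuous, hence bounded on the compact ball. The sum of
  their norms bounds the operator norm of the derivative, and convexity of the ball allows the mean
  value inequality.\<close>

lemma smooth_lipschitz_on_cball:
  fixes f :: "'a::euclidean_space \<Rightarrow> 'b::real_normed_vector"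
  assumes f: "smooth_on UNIV f"
  obtains B where "B \<ge> 0" "\<And>x y. x \<in> cball 0 R \<Longrightarrow> y \<in> cball 0 R \<Longrightarrow> norm (f x - f y) \<le> B * norm (x - y)"
proof -
  define D where "D x = frechet_derivative f (at x)" for x
  have D: "(f has_derivative D x) (at x)" for x
    using smooth_on_differentiable[OF f] frechet_derivative_works unfolding D_def by blast
  have "continuous_on UNIV (\<lambda>x. D x b)" for b
    using f unfolding smooth_on_def D_def by (metis Ck_on.simps)
  then have "continuous_on (cball 0 R) (\<lambda>x. \<Sum>b\<in>Basis. norm (D x b))"
    by (intro continuous_intros) (blast intro: continuous_on_subset)
  then have "bounded ((\<lambda>x. \<Sum>b\<in>Basis. norm (D x b)) ` cball 0 R)"
    by (intro compact_imp_bounded compact_continuous_image) auto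
  then obtain B where B: "B > 0" "\<And>x. x \<in> cball 0 R \<Longrightarrow> \<bar>\<Sum>b\<in>Basis. norm (D x b)\<bar> \<le> B"
    unfolding bounded_pos by (auto simp: image_iff)
  have "onorm (D x) \<le> B" if "x \<in> cball 0 R" for x
  proof (rule onorm_le)
    fix v
    interpret bounded_linear "D x" using D by (rule has_derivative_bounded_linear)
    have "norm (D x v) = norm (\<Sum>b\<in>Basis. (v \<bullet> b) *\<^sub>R D x b)"
      by (subst euclidean_representation[of v, symmetric]) (simp only: sum scaleR)
    also have "\<dots> \<le> (\<Sum>b\<in>Basis. norm v * norm (D x b))"
      by (rule sum_norm_le) (simp add: Basis_le_norm mult_right_mono)
    also have "\<dots> = (\<Sum>b\<in>Basis. norm (D x b)) * norm v"
      by (simp add: sum_distrib_left mult.commute)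
    also have "\<dots> \<le> B * norm v"
      using B(2)[OF that] by (intro mult_right_mono) auto
    finally show "norm (D x v) \<le> B * norm v" .
  qed
  then have "norm (f x - f y) \<le> B * norm (x - y)" if "x \<in> cball 0 R" "y \<in> cball 0 R" for x y
    using that by (intro differentiable_bound[of "cball 0 R" f D])
      (auto intro: has_derivative_at_withinI[OF D])
  with B(1) that[of B] show ?thesis by auto
qed

text \<open>Gronwall argument: the squared distance of the two solutions grows at rate at most
  \<open>2 * B\<close>, so after multiplication by \<open>exp (- 2 * B * r)\<close> it is
  nonincreasing. It starts at 0 and therefore stays there.\<close>

lemma solution_unique_unit_interval:
  fixes h :: "'a::euclidean_space \<Rightarrow> 'a"
  assumes h: "\<And>x y. x \<in> S \<Longrightarrow> y \<in> S \<Longrightarrow> norm (h x - h y) \<le> B * norm (x - y)"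
    and \<phi>: "\<And>r. r \<in> {0..1} \<Longrightarrow> (\<phi> has_vector_derivative h (\<phi> r)) (at r within {0..1})"
    and \<psi>: "\<And>r. r \<in> {0..1} \<Longrightarrow> (\<psi> has_vector_derivative h (\<psi> r)) (at r within {0..1})"
    and S: "\<phi> ` {0..1} \<subseteq> S" "\<psi> ` {0..1} \<subseteq> S" and eq0: "\<phi> 0 = \<psi> 0"
  shows "\<phi> (1::real) = \<psi> 1"
proof -
  define u where "u r = \<phi> r - \<psi> r" for r
  define g where "g r = (u r \<bullet> u r) * exp (- 2 * B * r)" for r
  have u: "(u has_vector_derivative (h (\<phi> r) - h (\<psi> r))) (at r within {0..1})"
    if "r \<in> {0..1}" for r
    unfolding u_def using \<phi> \<psi> that by (intro has_vector_derivative_diff) auto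
  have "continuous_on {0..1} u"
    using u by (meson continuous_on_eq_continuous_within has_vector_derivative_continuous)
  then have cont: "continuous_on {0..1} g"
    unfolding g_def by (intro continuous_intros)
  \<comment> \<open>At interior points the one-sided restriction in the derivative disappears; the
    endpoints are reached through continuity of \<open>g\<close>.\<close>
  have der: "\<exists>y. (g has_real_derivative y) (at r) \<and> y \<le> 0" if r: "0 < r" "r < 1" for r
  proof -
    have "(u has_vector_derivative (h (\<phi> r) - h (\<psi> r))) (at r)"
      using u[of r] r at_within_Icc_at[of 0 r 1] by auto
    then have "(u has_derivative (\<lambda>s. s *\<^sub>R (h (\<phi> r) - h (\<psi> r)))) (at r)"
      by (simp add: has_vector_derivative_def)
    from has_derivative_inner[OF this this]
    have "((\<lambda>r. u r \<bullet> u r) has_real_derivative 2 * (u r \<bullet> (h (\<phi> r) - h (\<psi> r)))) (at r)"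
      by (rule has_derivative_imp_has_field_derivative) (simp add: inner_commute algebra_simps)
    then have "(g has_real_derivative
        2 * (u r \<bullet> (h (\<phi> r) - h (\<psi> r)) - B * (u r \<bullet> u r)) * exp (- 2 * B * r)) (at r)"
      unfolding g_def by (auto intro!: derivative_eq_intros simp: algebra_simps)
    moreover have "u r \<bullet> (h (\<phi> r) - h (\<psi> r)) \<le> B * (u r \<bullet> u r)"
    proof -
      have "u r \<bullet> (h (\<phi> r) - h (\<psi> r)) \<le> norm (u r) * norm (h (\<phi> r) - h (\<psi> r))"
        by (rule norm_cauchy_schwarz)
      also have "\<dots> \<le> norm (u r) * (B * norm (u r))"
        unfolding u_def using S r by (intro mult_left_mono h) auto
      finally show ?thesis by (simp add: dot_square_norm power2_eq_square algebra_simps)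
    qed
    ultimately show ?thesis by (auto intro!: exI mult_nonpos_nonneg)
  qed
  have "\<exists>y. ((\<lambda>r. - g r) has_real_derivative y) (at r) \<and> y \<ge> 0" if "0 < r" "r < 1" for r
    using der[OF that] DERIV_minus by (metis neg_0_le_iff_le)
  then have "- g 0 \<le> - g 1"
    by (rule DERIV_nonneg_imp_increasing_open[of 0 1 "\<lambda>r. - g r", rotated])
      (auto intro: continuous_on_minus cont)
  then have "u 1 \<bullet> u 1 \<le> 0"
    by (simp add: g_def u_def eq0 mult_le_0_iff)
  then have "u 1 = 0" by (metis inner_gt_zero_iff not_le)
  then show ?thesis by (simp add: u_def)
qed

text \<open>Substituting \<open>r * t\<close> for time turns both solutions into solutions of
  \<open>t *\<^sub>R f\<close> on the unit interval, which treats positive and negative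
  \<open>t\<close> alike. Smoothness gives only a local Lipschitz bound, so both curves are first
  enclosed in one ball.\<close>

lemma flow_to_unique:
  fixes f :: "'a::euclidean_space \<Rightarrow> 'a"
  assumes f: "smooth_on UNIV f" and "flow_to f t x y" "flow_to f t x z"
  shows "y = z"
proof -
  have rescale: "\<exists>\<phi>. \<phi> 0 = x \<and> \<phi> 1 = y \<and>
      (\<forall>r\<in>{0..1}. (\<phi> has_vector_derivative t *\<^sub>R f (\<phi> r)) (at r within {0..1}))"
    if sol: "flow_to f t x y" for y
  proof -
    obtain \<phi> where \<phi>: "\<phi> 0 = x" "\<phi> t = y"
      "\<And>s. s \<in> closed_segment 0 t \<Longrightarrow>
        (\<phi> has_vector_derivative f (\<phi> s)) (at s within closed_segment 0 t)"
      using sol unfolding flow_to_def by blast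
    have img: "(\<lambda>r. r * t) ` {0..1} = closed_segment 0 t"
      by (auto simp: closed_segment_def)
    have "((\<phi> \<circ> (\<lambda>r. r * t)) has_vector_derivative t *\<^sub>R f (\<phi> (r * t))) (at r within {0..1})"
      if "r \<in> {0..1}" for r
    proof (rule vector_diff_chain_within)
      show "((\<lambda>r. r * t) has_vector_derivative t) (at r within {0..1})"
        by (auto intro!: derivative_eq_intros simp flip: has_real_derivative_iff_has_vector_derivative)
      show "(\<phi> has_vector_derivative f (\<phi> (r * t))) (at (r * t) within (\<lambda>r. r * t) ` {0..1})"
        unfolding img using that by (intro \<phi>(3)) (auto simp: closed_segment_def)
    qed
    with \<phi>(1,2) show ?thesis by (intro exI[of _ "\<phi> \<circ> (\<lambda>r. r * t)"]) auto
  qed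
  from rescale[OF assms(2)] obtain \<phi> where \<phi>: "\<phi> 0 = x" "\<phi> 1 = y"
      "\<And>r. r\<in>{0..1} \<Longrightarrow> (\<phi> has_vector_derivative t *\<^sub>R f (\<phi> r)) (at r within {0..1})" by blast
  from rescale[OF assms(3)] obtain \<psi> where \<psi>: "\<psi> 0 = x" "\<psi> 1 = z"
      "\<And>r. r\<in>{0..1} \<Longrightarrow> (\<psi> has_vector_derivative t *\<^sub>R f (\<psi> r)) (at r within {0..1})" by blast
  have "continuous_on {0..1} \<phi>" "continuous_on {0..1} \<psi>"
    using \<phi>(3) \<psi>(3) by (meson continuous_on_eq_continuous_within has_vector_derivative_continuous)+
  then have "bounded (\<phi> ` {0..1} \<union> \<psi> ` {0..1})"
    by (simp add: compact_continuous_image compact_imp_bounded)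
  then obtain R where R: "\<phi> ` {0..1} \<union> \<psi> ` {0..1} \<subseteq> cball 0 R"
    unfolding bounded_iff by (auto simp: subset_iff)
  obtain B where B: "\<And>x y. x \<in> cball 0 R \<Longrightarrow> y \<in> cball 0 R \<Longrightarrow> norm (f x - f y) \<le> B * norm (x - y)"
    using smooth_lipschitz_on_cball[OF f] by metis
  have lip: "norm (t *\<^sub>R f x - t *\<^sub>R f y) \<le> \<bar>t\<bar> * B * norm (x - y)"
    if "x \<in> cball 0 R" "y \<in> cball 0 R" for x y
    using mult_left_mono[OF B[OF that], of "\<bar>t\<bar>"]
    by (simp add: mult.assoc flip: scaleR_diff_right)
  have "\<phi> 1 = \<psi> 1"
  proof (rule solution_unique_unit_interval[OF _ \<phi>(3) \<psi>(3)])
    fix x y :: 'a assume "x \<in> cball 0 R" "y \<in> cball 0 R"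
    then show "norm (t *\<^sub>R f x - t *\<^sub>R f y) \<le> \<bar>t\<bar> * B * norm (x - y)" by (rule lip)
  next
    show "\<phi> ` {0..1} \<subseteq> cball 0 R" "\<psi> ` {0..1} \<subseteq> cball 0 R" using R by auto
    show "\<phi> 0 = \<psi> 0" using \<phi>(1) \<psi>(1) by simp
  qed
  then show ?thesis using \<phi>(2) \<psi>(2) by simp
qed

section \<open>Elementary properties of the flow\<close>

lemma flow_eqI:
  assumes "smooth_on UNIV f" "flow_to f t x y"
  shows "flow f t x = y"
  unfolding flow_def using assms flow_to_unique by blast

text \<open>The vector field is autonomous, so a time shift of a solution is again a solution. The
  order of \<open>a\<close> and \<open>b\<close> is free, which covers running backward as well as
  forward.\<close>

lemma flow_to_between:
  assumes \<phi>: "\<And>s. s \<in> closed_segment 0 t \<Longrightarrow>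
      (\<phi> has_vector_derivative f (\<phi> s)) (at s within closed_segment 0 t)"
    and ab: "a \<in> closed_segment 0 t" "b \<in> closed_segment 0 t"
  shows "flow_to f (b - a) (\<phi> a) (\<phi> b)"
  unfolding flow_to_def
proof (intro exI[of _ "\<phi> \<circ> (\<lambda>s. a + s)"] conjI ballI)
  fix s assume s: "s \<in> closed_segment 0 (b - a)"
  have img: "(\<lambda>s. a + s) ` closed_segment 0 (b - a) = closed_segment a b"
    using closed_segment_translation[of a 0 "b - a"] by simp
  have sub: "closed_segment a b \<subseteq> closed_segment 0 t"
    using ab by (simp add: subset_closed_segment)
  have "((\<phi> \<circ> (\<lambda>s. a + s)) has_vector_derivative 1 *\<^sub>R f (\<phi> (a + s)))
      (at s within closed_segment 0 (b - a))"
  proof (rule vector_diff_chain_within)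
    show "((\<lambda>s. a + s) has_vector_derivative 1) (at s within closed_segment 0 (b - a))"
      by (auto intro!: derivative_eq_intros simp flip: has_real_derivative_iff_has_vector_derivative)
    have "a + s \<in> closed_segment 0 t" using s img sub by blast
    then show "(\<phi> has_vector_derivative f (\<phi> (a + s)))
        (at (a + s) within (\<lambda>s. a + s) ` closed_segment 0 (b - a))"
      unfolding img by (rule has_vector_derivative_within_subset[OF \<phi> sub])
  qed
  then show "((\<phi> \<circ> (\<lambda>s. a + s)) has_vector_derivative f ((\<phi> \<circ> (\<lambda>s. a + s)) s))
      (at s within closed_segment 0 (b - a))" by simp
qed auto

text \<open>By uniqueness, the single curve that witnesses existence at time \<open>t\<close>
  computes the flow at every intermediate time. This replaces the definite description in
  \<open>flow\<close> by a differentiable curve.\<close>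

lemma obtain_solution:
  assumes f: "smooth_on UNIV f" and t: "t \<in> flow_times f x"
  obtains \<phi> where "\<And>s. s \<in> closed_segment 0 t \<Longrightarrow>
      (\<phi> has_vector_derivative f (\<phi> s)) (at s within closed_segment 0 t)"
    "\<And>s. s \<in> closed_segment 0 t \<Longrightarrow> flow f s x = \<phi> s" "\<phi> 0 = x"
proof -
  obtain \<phi> where \<phi>: "\<phi> 0 = x" "\<And>s. s \<in> closed_segment 0 t \<Longrightarrow>
      (\<phi> has_vector_derivative f (\<phi> s)) (at s within closed_segment 0 t)"
    using t unfolding flow_times_def flow_to_def by blast
  have "flow f s x = \<phi> s" if "s \<in> closed_segment 0 t" for s
    using flow_eqI[OF f flow_to_between[OF \<phi>(2) ends_in_segment(1) that]] \<phi>(1) by simp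
  with \<phi> that show ?thesis by blast
qed

text \<open>This is the group law of the flow. Keeping \<open>a\<close> and \<open>b\<close> between
  0 and \<open>t\<close> places everything on one solution curve, so no solutions have to be
  glued.\<close>

lemma flow_flow:
  assumes f: "smooth_on UNIV f" and t: "t \<in> flow_times f x"
    and "a \<in> closed_segment 0 t" "b \<in> closed_segment 0 t"
  shows "flow f (b - a) (flow f a x) = flow f b x"
proof -
  obtain \<phi> where \<phi>: "\<And>s. s \<in> closed_segment 0 t \<Longrightarrow>
      (\<phi> has_vector_derivative f (\<phi> s)) (at s within closed_segment 0 t)"
    "\<And>s. s \<in> closed_segment 0 t \<Longrightarrow> flow f s x = \<phi> s"
    using obtain_solution[OF f t] by blast
  from flow_eqI[OF f flow_to_between[OF \<phi>(1) assms(3,4)]] show ?thesis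
    using \<phi>(2) assms(3,4) by simp
qed

lemma flow_0:
  assumes "smooth_on UNIV f" and "t \<in> flow_times f x"
  shows "flow f 0 x = x"
  by (rule obtain_solution[OF assms]) (metis ends_in_segment(1))

section \<open>Stability and unstable manifolds\<close>

lemma unstable_manifold_subset_asymptotically_stable:
  fixes f :: "'a::euclidean_space \<Rightarrow> 'a"
  assumes f: "smooth_on UNIV f" and X: "closed X" "p \<in> X" and stable: "asymptotically_stable f X"
  shows "unstable_manifold f p \<subseteq> X"
proof
  fix x assume "x \<in> unstable_manifold f p"
  then have x: "{..0} \<subseteq> flow_times f x" "((\<lambda>t. flow f t x) \<longlongrightarrow> p) at_bot"
    unfolding unstable_manifold_def by auto
  show "x \<in> X"
  proof (rule ccontr)
    assume "x \<notin> X"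
    then have "infdist x X > 0"
      using X by (metis empty_iff in_closed_iff_infdist_zero infdist_nonneg less_eq_real_def)
    then obtain \<epsilon> where \<epsilon>: "\<epsilon> > 0" "nbhd \<epsilon> X \<subseteq> basin f (infdist x X) X"
      using stable unfolding asymptotically_stable_def by blast
    \<comment> \<open>Strict negativity of \<open>t\<close> makes the return time
      \<open>0 - t\<close> positive, as the distance condition in \<open>basin\<close>
      requires.\<close>
    have "\<forall>\<^sub>F t in at_bot. dist (flow f t x) p < \<epsilon> \<and> t < 0"
      using tendstoD[OF x(2) \<epsilon>(1)] eventually_gt_at_bot[of 0] eventually_conj by fastforce
    then obtain t where t: "dist (flow f t x) p < \<epsilon>" "t < 0"
      using eventually_happens'[OF trivial_limit_at_bot_linorder] by blast
    have "flow f t x \<in> nbhd \<epsilon> X"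
      unfolding nbhd_def using infdist_le[OF X(2), of "flow f t x"] t by auto
    then have "infdist (flow f (0 - t) (flow f t x)) X < infdist x X"
      using \<epsilon>(2) t(2) unfolding basin_def by auto
    \<comment> \<open>Flowing forward for time \<open>- t\<close> returns to \<open>x\<close>, which
      would then be closer to \<open>X\<close> than it is.\<close>
    moreover have "t \<in> flow_times f x" using x(1) t(2) by auto
    then have "flow f (0 - t) (flow f t x) = x"
      using flow_flow[OF f, of t x t 0] flow_0[OF f] by simp
    ultimately show False by simp
  qed
qed

text \<open>Of two points on a common trajectory, one lies on the backward orbit of the other; by symmetry
  the proof treats only that case.\<close>

lemma unstable_manifold_same_trajectory:
  fixes f :: "'a::euclidean_space \<Rightarrow> 'a"
  assumes f: "smooth_on UNIV f"
    and x: "x \<in> unstable_manifold f p" and y: "y \<in> unstable_manifold f q"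
    and eq: "trajectory f x = trajectory f y"
  shows "p = q"
proof -
  have backward: "p = q" if x: "x \<in> unstable_manifold f p" and y: "flow f s x \<in> unstable_manifold f q"
    and s: "s \<le> 0" for x p q s
  proof -
    have x: "{..0} \<subseteq> flow_times f x" "((\<lambda>t. flow f t x) \<longlongrightarrow> p) at_bot"
      using x unfolding unstable_manifold_def by auto
    have "((\<lambda>t. flow f t (flow f s x)) \<longlongrightarrow> q) at_bot"
      using y unfolding unstable_manifold_def by auto
    moreover have "filterlim (\<lambda>t. t - s) at_bot at_bot"
      unfolding filterlim_at_bot eventually_at_bot_linorder
      by (metis diff_le_eq)
    ultimately have "((\<lambda>t. flow f (t - s) (flow f s x)) \<longlongrightarrow> q) at_bot"
      by (rule filterlim_compose)
    \<comment> \<open>Once \<open>t \<le> s \<le> 0\<close>, the time \<open>s\<close> lies between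
      0 and \<open>t\<close>, so the group law applies. The backward limits from both points then
      agree.\<close>
    moreover have "\<forall>\<^sub>F t in at_bot. flow f (t - s) (flow f s x) = flow f t x"
      using eventually_le_at_bot[of s]
    proof eventually_elim
      case (elim t)
      then have "t \<in> flow_times f x" using x(1) s by auto
      then show ?case
        using elim s by (intro flow_flow[OF f]) (auto simp: closed_segment_eq_real_ivl)
    qed
    ultimately have "((\<lambda>t. flow f t x) \<longlongrightarrow> q) at_bot"
      by (rule Lim_transform_eventually)
    with x(2) show ?thesis
      using tendsto_unique trivial_limit_at_bot_linorder by blast
  qed
  have "0 \<in> flow_times f y"
    using y unfolding unstable_manifold_def by auto
  then have "y \<in> trajectory f y"
    using flow_0[OF f] unfolding trajectory_def by force
  then obtain s where s: "s \<in> flow_times f x" "y = flow f s x"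
    using eq unfolding trajectory_def by auto
  show ?thesis
  proof (cases "s \<le> 0")
    case True
    then show ?thesis using backward x y s by blast
  next
    case False
    have "flow f (0 - s) (flow f s x) = x"
      using flow_flow[OF f s(1), of s 0] flow_0[OF f s(1)] by simp
    then show ?thesis using backward[OF y, of "- s" p] x False s by simp
  qed
qed

section \<open>Countable unions of curves contain no surfaces\<close>

text \<open>Curves are images of arbitrary sets \<open>I\<close> of reals, not only of intervals.
  Thus \<open>I\<close> can be cut down to the parameters that land in the chart domain, and single
  points count as curves.\<close>

lemma embedded_submanifold_not_subset_countable_curves:
  fixes S :: "'a::euclidean_space set"
  assumes emb: "embedded_submanifold k S" and k: "k \<ge> 2" and "S \<noteq> {}"
    and F: "countable F"
      "\<And>K. K \<in> F \<Longrightarrow> \<exists>(\<phi> :: real \<Rightarrow> 'a) I. \<phi> differentiable_on I \<and> K = \<phi> ` I"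
  shows "\<not> S \<subseteq> \<Union> F"
proof
  assume sub: "S \<subseteq> \<Union> F"
  from \<open>S \<noteq> {}\<close> obtain p where "p \<in> S" by blast
  then obtain U V :: "'a set" and \<psi> \<psi>' :: "'a \<Rightarrow> 'a" and L
    where p: "p \<in> U" and U: "open U" and V: "open V" and \<psi>: "smooth_on U \<psi>"
      and L: "subspace L" "dim L = k" and slice: "\<psi> ` (S \<inter> U) = L \<inter> V"
    using emb unfolding embedded_submanifold_def by meson
  obtain E where E: "E \<subseteq> L" "pairwise orthogonal E" "\<And>x. x \<in> E \<Longrightarrow> norm x = 1" "card E = dim L"
    using orthonormal_basis_subspace[OF L(1)] by metis
  obtain e1 e2 where e: "e1 \<in> E" "e2 \<in> E" "e1 \<noteq> e2"
    using E(4) L(2) k by (metis One_nat_def card_le_Suc0_iff_eq card.infinite not_less_eq_eq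
        numeral_2_eq_2 le_trans zero_le not_numeral_le_zero)
  have ee: "e1 \<bullet> e1 = 1" "e2 \<bullet> e2 = 1" "e1 \<bullet> e2 = 0" "e2 \<bullet> e1 = 0"
    using e E(2,3) by (auto simp: norm_eq_1 pairwise_def orthogonal_def)
  \<comment> \<open>The type \<open>complex\<close> serves as the Euclidean plane. The map
    \<open>h\<close> parametrizes the plane through \<open>\<psi> p\<close> spanned by
    \<open>e1\<close> and \<open>e2\<close>, which lies in \<open>L\<close>; the projection
    \<open>\<pi>\<close> is its left inverse.\<close>
  define h where "h z = \<psi> p + Re z *\<^sub>R e1 + Im z *\<^sub>R e2" for z
  define \<pi> where "\<pi> y = ((y - \<psi> p) \<bullet> e1) *\<^sub>R 1 + ((y - \<psi> p) \<bullet> e2) *\<^sub>R \<i>" for y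
  have \<pi>h: "\<pi> (h z) = z" for z
    by (simp add: \<pi>_def h_def inner_add_left ee complex_eq_iff)
  have "\<psi> p \<in> L \<inter> V" using p \<open>p \<in> S\<close> slice by blast
  then have hL: "h z \<in> L" for z
    unfolding h_def using e E(1) L(1) by (auto intro!: subspace_add subspace_scale)
  have "continuous_on UNIV h"
    unfolding h_def by (intro continuous_intros)
  then have "open (h -` V)" using V by (rule open_vimage[rotated])
  moreover have "0 \<in> h -` V" using \<open>\<psi> p \<in> L \<inter> V\<close> by (simp add: h_def)
  ultimately have "\<not> negligible (h -` V)" using open_not_negligible by blast
  \<comment> \<open>A point of the plane inside \<open>V\<close> lies in the slice
    \<open>L \<inter> V\<close>, so it comes through the chart from a point of \<open>S\<close>, and
    that point lies on some curve of \<open>F\<close>.\<close>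
  moreover have "h -` V \<subseteq> (\<Union>K\<in>F. (\<pi> \<circ> \<psi>) ` (K \<inter> U))"
  proof
    fix z assume "z \<in> h -` V"
    then have "h z \<in> \<psi> ` (S \<inter> U)" using hL slice by blast
    then obtain x where "x \<in> S" "x \<in> U" "h z = \<psi> x" by blast
    moreover from this obtain K where "K \<in> F" "x \<in> K" using sub by blast
    moreover have "z = (\<pi> \<circ> \<psi>) x" using \<pi>h[of z] \<open>h z = \<psi> x\<close> by simp
    ultimately show "z \<in> (\<Union>K\<in>F. (\<pi> \<circ> \<psi>) ` (K \<inter> U))" by blast
  qed
  moreover have "negligible (\<Union>K\<in>F. (\<pi> \<circ> \<psi>) ` (K \<inter> U))"
  proof (rule negligible_countable_Union)
    show "countable ((\<lambda>K. (\<pi> \<circ> \<psi>) ` (K \<inter> U)) ` F)" using F(1) by simp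
    fix M assume "M \<in> (\<lambda>K. (\<pi> \<circ> \<psi>) ` (K \<inter> U)) ` F"
    then obtain K \<phi> I where M: "M = (\<pi> \<circ> \<psi>) ` (K \<inter> U)" "K = \<phi> ` I"
      and \<phi>: "\<phi> differentiable_on (I :: real set)"
      using F(2) by blast
    have "(\<pi> has_derivative (\<lambda>v. (v \<bullet> e1) *\<^sub>R 1 + (v \<bullet> e2) *\<^sub>R \<i>)) (at y)" for y
      unfolding \<pi>_def by (auto intro!: derivative_eq_intros)
    then have d\<pi>: "\<pi> differentiable_on (\<lambda>s. \<psi> (\<phi> s)) ` {s \<in> I. \<phi> s \<in> U}"
      by (meson differentiable_at_imp_differentiable_on differentiable_def)
    have d\<psi>: "\<psi> differentiable_on \<phi> ` {s \<in> I. \<phi> s \<in> U}"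
      using smooth_on_differentiable[OF \<psi>] by (intro differentiable_at_imp_differentiable_on) auto
    have d\<phi>: "\<phi> differentiable_on {s \<in> I. \<phi> s \<in> U}"
      using \<phi> by (rule differentiable_on_subset) auto
    have "(\<lambda>s. \<pi> (\<psi> (\<phi> s))) differentiable_on {s \<in> I. \<phi> s \<in> U}"
      by (rule differentiable_on_compose[of "\<lambda>s. \<psi> (\<phi> s)", OF differentiable_on_compose[OF d\<phi> d\<psi>] d\<pi>])
    \<comment> \<open>A differentiable image of a subset of the line has measure zero in the plane,
      since 1 < 2.\<close>
    then have "negligible ((\<lambda>s. \<pi> (\<psi> (\<phi> s))) ` {s \<in> I. \<phi> s \<in> U})"
      by (intro negligible_differentiable_image_lowdim) auto
    moreover have "M = (\<lambda>s. \<pi> (\<psi> (\<phi> s))) ` {s \<in> I. \<phi> s \<in> U}"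
      unfolding M by auto
    ultimately show "negligible M" by simp
  qed
  ultimately show False using negligible_subset by blast
qed

text \<open>A time in \<open>flow_times\<close> provides a solution curve only on the segment from 0
  to that time. Segments ending at integers of either sign exhaust the line, and there are countably
  many of them.\<close>

lemma trajectory_countable_Union_arcs:
  fixes f :: "'a::euclidean_space \<Rightarrow> 'a"
  assumes f: "smooth_on UNIV f" and x: "flow_times f x = UNIV"
  obtains F where "countable F" "trajectory f x = \<Union> F"
    "\<And>K. K \<in> F \<Longrightarrow> \<exists>(\<phi> :: real \<Rightarrow> 'a) I. \<phi> differentiable_on I \<and> K = \<phi> ` I"
proof
  define A where "A n = (\<lambda>t. flow f t x) ` closed_segment 0 (real_of_int n)" for n
  show "countable (range A)" by simp
  have "\<exists>n. t \<in> closed_segment 0 (real_of_int n)" for t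
  proof (cases "t \<ge> 0")
    case True
    then show ?thesis
      by (intro exI[of _ "\<lceil>t\<rceil>"]) (auto simp: closed_segment_eq_real_ivl)
  next
    case False
    then show ?thesis
      by (intro exI[of _ "\<lfloor>t\<rfloor>"]) (auto simp: closed_segment_eq_real_ivl)
  qed
  then show "trajectory f x = \<Union> (range A)"
    unfolding trajectory_def A_def x by blast
  fix K assume "K \<in> range A"
  then obtain n where K: "K = A n" by blast
  have "real_of_int n \<in> flow_times f x" using x by simp
  from obtain_solution[OF f this] obtain \<phi> where
    \<phi>: "\<And>s. s \<in> closed_segment 0 (real_of_int n) \<Longrightarrow>
      (\<phi> has_vector_derivative f (\<phi> s)) (at s within closed_segment 0 (real_of_int n))"
    "\<And>s. s \<in> closed_segment 0 (real_of_int n) \<Longrightarrow> flow f s x = \<phi> s" by blast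
  have "\<phi> differentiable_on closed_segment 0 (real_of_int n)"
    using \<phi>(1) unfolding differentiable_on_def
    by (blast intro: differentiableI_vector)
  moreover have "K = \<phi> ` closed_segment 0 (real_of_int n)"
    unfolding K A_def using \<phi>(2) by (rule image_cong[OF refl])
  ultimately show "\<exists>(\<phi> :: real \<Rightarrow> 'a) I. \<phi> differentiable_on I \<and> K = \<phi> ` I" by blast
qed

theorem corollary3p2:
  fixes f :: "real^'n \<Rightarrow> real^'n"
    and \<Gamma> :: "(real^'n^'n) set"
    and C :: "(real^'n) cycle_data set"
    and X :: "(real^'n) set"
    and \<xi> :: "real^'n"
  assumes "smooth_on UNIV f"
    and "matrix_group \<Gamma>" and "compact \<Gamma>" and "equivariant \<Gamma> f"
    and "heteroclinic_network f \<Gamma> C X"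
    and "\<forall>c\<in>C. robust_cycle f \<Gamma> c"
    and "compact X"
    and "finite (\<Union>c\<in>C. cycle_connections c)"
    and "\<forall>K\<in>(\<Union>c\<in>C. cycle_connections c). immersed_submanifold 1 K"
    and "\<xi> \<in> (\<Union>c\<in>C. cycle_equilibria c)"
    and "\<exists>k\<ge>2. immersed_submanifold k (unstable_manifold f \<xi>)"
  shows "\<not> asymptotically_stable f X"
proof
  assume stable: "asymptotically_stable f X"
  note f = \<open>smooth_on UNIV f\<close>
  let ?E = "\<Union>c\<in>C. cycle_equilibria c" and ?K = "\<Union>c\<in>C. cycle_connections c"
  have X: "X = ?E \<union> \<Union> ?K" and cyc: "\<And>c. c \<in> C \<Longrightarrow> heteroclinic_cycle f \<Gamma> c"
    using assms(5) unfolding heteroclinic_network_def cycle_set_def by auto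
  \<comment> \<open>Every equilibrium of a cycle has an outgoing connection within that
    cycle.\<close>
  have node: "\<exists>K\<in>?K. \<exists>x \<in> unstable_manifold f p. K = trajectory f x" if p: "p \<in> ?E" for p
  proof -
    obtain c j where cj: "c \<in> C" "j \<in> {1..len c}" "p = node c j"
      using p unfolding cycle_equilibria_def by blast
    then obtain x where "x \<in> unstable_manifold f p" "conn c j = trajectory f x"
      using cyc unfolding heteroclinic_cycle_def is_connection_def by blast
    moreover have "conn c j \<in> ?K" using cj unfolding cycle_connections_def by blast
    ultimately show ?thesis by blast
  qed
  then obtain \<kappa> where \<kappa>: "\<And>p. p \<in> ?E \<Longrightarrow> \<kappa> p \<in> ?K"
    "\<And>p. p \<in> ?E \<Longrightarrow> \<exists>x \<in> unstable_manifold f p. \<kappa> p = trajectory f x"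
    by metis
  \<comment> \<open>A trajectory determines its backward limit, so distinct equilibria have distinct
    outgoing connections. Finiteness of the set of equilibria thus follows from that of the
    connections, although \<open>C\<close> itself may be infinite.\<close>
  have "inj_on \<kappa> ?E"
    using \<kappa>(2) unstable_manifold_same_trajectory[OF f] by (intro inj_onI) metis
  then have E: "finite ?E"
    using \<kappa>(1) assms(8) by (auto intro: inj_on_finite[of \<kappa> ?E ?K])
  have "\<exists>F. countable F \<and> K = \<Union> F \<and>
      (\<forall>A\<in>F. \<exists>(\<phi> :: real \<Rightarrow> real^'n) I. \<phi> differentiable_on I \<and> A = \<phi> ` I)" if K: "K \<in> ?K" for K
  proof -
    obtain c j where "c \<in> C" "j \<in> {1..len c}" "K = conn c j"
      using K unfolding cycle_connections_def by blast
    then obtain p q x where x: "x \<in> unstable_manifold f p" "x \<in> stable_manifold f q" "K = trajectory f x"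
      using cyc unfolding heteroclinic_cycle_def is_connection_def by blast
    \<comment> \<open>A connection has limits in both time directions, so its solution exists for
      all times even if \<open>f\<close> is not complete.\<close>
    then have "{..0} \<union> {0..} \<subseteq> flow_times f x"
      unfolding unstable_manifold_def stable_manifold_def by blast
    moreover have "{..0} \<union> {0..} = (UNIV :: real set)" by auto
    ultimately have "flow_times f x = UNIV" by blast
    from trajectory_countable_Union_arcs[OF f this] x(3) show ?thesis by metis
  qed
  then obtain F where F: "\<And>K. K \<in> ?K \<Longrightarrow> countable (F K)" "\<And>K. K \<in> ?K \<Longrightarrow> K = \<Union> (F K)"
    "\<And>K A. K \<in> ?K \<Longrightarrow> A \<in> F K \<Longrightarrow>
      \<exists>(\<phi> :: real \<Rightarrow> real^'n) I. \<phi> differentiable_on I \<and> A = \<phi> ` I"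
    by metis
  \<comment> \<open>The equilibria enter as degenerate curves, namely constant maps on a one-point
    parameter set.\<close>
  let ?F = "(\<lambda>p. {p}) ` ?E \<union> (\<Union>K\<in>?K. F K)"
  have F_countable: "countable ?F"
    using countable_finite[OF E] countable_finite[OF assms(8)] F(1)
    by (intro countable_Un countable_image countable_UN[of ?K]) blast+
  have F_arcs: "\<exists>(\<phi> :: real \<Rightarrow> real^'n) I. \<phi> differentiable_on I \<and> A = \<phi> ` I" if "A \<in> ?F" for A
  proof -
    have "\<exists>(\<phi> :: real \<Rightarrow> real^'n) I. \<phi> differentiable_on I \<and> {p} = \<phi> ` I" for p
      by (intro exI[of _ "\<lambda>_. p"] exI[of _ "{0}"]) auto
    moreover have "(\<exists>p. A = {p}) \<or> (\<exists>K\<in>?K. A \<in> F K)" using that by blast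
    ultimately show ?thesis using F(3) by metis
  qed
  have "\<Union> ?K \<subseteq> \<Union> ?F"
  proof
    fix x assume "x \<in> \<Union> ?K"
    then obtain K where K: "K \<in> ?K" "x \<in> K" by (rule UnionE)
    then have "x \<in> \<Union> (F K)" using F(2)[OF K(1)] by simp
    then show "x \<in> \<Union> ?F" using K(1) by blast
  qed
  moreover have "?E \<subseteq> \<Union> ?F" by blast
  ultimately have X_F: "X \<subseteq> \<Union> ?F" unfolding X by (rule Un_least[rotated])
  \<comment> \<open>The unstable manifold is only immersed and may accumulate on itself. A
    \<open>T\<close>-open piece \<open>N\<close> of it is embedded, and this piece already has
    dimension \<open>k\<close>.\<close>
  obtain k T where k: "k \<ge> 2" and T: "topspace T = unstable_manifold f \<xi>"
    "\<And>p. p \<in> unstable_manifold f \<xi> \<Longrightarrow> \<exists>N. openin T N \<and> p \<in> N \<and> embedded_submanifold k N"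
    using assms(11) unfolding immersed_submanifold_def by metis
  \<comment> \<open>The outgoing connection of \<open>\<xi>\<close> supplies a point of the unstable
    manifold, which makes the piece \<open>N\<close> nonempty.\<close>
  obtain p where "p \<in> unstable_manifold f \<xi>" using node assms(10) by blast
  then obtain N where N: "openin T N" "p \<in> N" "embedded_submanifold k N" using T by blast
  have "N \<subseteq> unstable_manifold f \<xi>" using N(1) T(1) openin_subset by blast
  also have "\<dots> \<subseteq> X"
    using assms(7,10) stable X
    by (intro unstable_manifold_subset_asymptotically_stable[OF f]) (auto simp: compact_imp_closed)
  also note X_F
  finally have "N \<subseteq> \<Union> ?F" .
  moreover have "N \<noteq> {}" using N(2) by blast
  then have "\<not> N \<subseteq> \<Union> ?F"
    by (rule embedded_submanifold_not_subset_countable_curves[OF N(3) k _ F_countable F_arcs])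
  ultimately show False by contradiction
qed

end
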